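(* Let $q$ be a prime power, let $k$ be a positive integer, let $i,j$ be integers with $j>i\ge 1$ and $\gcd(k,j-i)=1$, and let $f(x)=x^{q^i}+\delta x^{q^j}\in\mathcal{L}_{k,q}$ (with $\delta\in\mathbb{F}_{q^k}$). Then $f$ is a Sidon space polynomial.
   Context: $\mathcal{L}_{k,q}$ is the set of linearized polynomials ($q$-polynomials) $\sum_{i=0}^{t}f_ix^{q^i}$ with $f_i\in\mathbb{F}_{q^k}$; each is identified with the $\mathbb{F}_q$-linear map $\mathbb{F}_{q^k}\to\mathbb{F}_{q^k}$ it defines. For $x_0\in\mathbb{F}_{q^k}$ put $S_{x_0,f}=\{\lambda\in\mathbb{F}_{q^k} : f(\lambda x_0)=\lambda f(x_0)\}$. The polynomial $f$ is a Sidon space polynomial if $S_{x_0,f}\cap S_{x_1,f}=\mathbb{F}_q$ for all $x_0,x_1\in\mathbb{F}_{q^k}$ that are not $\mathbb{F}_q$-proportional (i.e. that are $\mathbb{F}_q$-linearly independent).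
   Formalization: The coefficient δ is assumed nonzero; for δ = 0 the claim fails, e.g. k = 2, i = 2, j = 3, where f(x) = x^{q^2} is the identity on F_{q^2} and every S_{x0,f} is all of F_{q^2}. *)

theory Defs
  imports "HOL-Computational_Algebra.Polynomial" "HOL-Number_Theory.Prime_Powers"
begin

definition subfield_set :: "'a :: field set \<Rightarrow> bool" where
  "subfield_set K \<longleftrightarrow>
     0 \<in> K \<and> 1 \<in> K \<and>
     (\<forall>a\<in>K. \<forall>b\<in>K. a - b \<in> K \<and> a * b \<in> K) \<and>
     (\<forall>a\<in>K. inverse a \<in> K)"

definition linearized_polys :: "nat \<Rightarrow> 'a :: field poly set" where
  "linearized_polys q = {f. \<exists>t c. f = (\<Sum>i\<le>t. monom (c i) (q ^ i))}"

definition S_set :: "'a :: field \<Rightarrow> 'a poly \<Rightarrow> 'a set" where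
  "S_set x0 f = {l. poly f (l * x0) = l * poly f x0}"

definition lin_indep_pair :: "'a :: field set \<Rightarrow> 'a \<Rightarrow> 'a \<Rightarrow> bool" where
  "lin_indep_pair K x y \<longleftrightarrow> (\<forall>a\<in>K. \<forall>b\<in>K. a * x + b * y = 0 \<longrightarrow> a = 0 \<and> b = 0)"

(* K plays the role of F_q inside the ambient field F_{q^k}; hence q is recovered as card K. *)
definition Sidon_space_poly :: "'a :: field set \<Rightarrow> 'a poly \<Rightarrow> bool" where
  "Sidon_space_poly K f \<longleftrightarrow>
     f \<in> linearized_polys (card K) \<and>
     (\<forall>x0 x1. lin_indep_pair K x0 x1 \<longrightarrow> S_set x0 f \<inter> S_set x1 f = K)"

end

theory Submission
  imports Defs
begin

text \<open>For nonzero \<open>x\<close>, membership of \<open>\<lambda>\<close> in the set attached to \<open>x\<close> reads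
  \<open>\<lambda>\<^bsup>q^i\<^esup> - \<lambda> = -\<delta> x\<^bsup>q^j - q^i\<^esup> (\<lambda>\<^bsup>q^j\<^esup> - \<lambda>)\<close>. If \<open>\<lambda>\<close> belongs to the sets of both \<open>x\<close> and
  \<open>y\<close>, then either \<open>\<lambda>\<^bsup>q^j\<^esup> \<noteq> \<lambda>\<close>, in which case \<open>x/y\<close> is fixed by the \<open>(j-i)\<close>-th power of
  Frobenius, or \<open>\<lambda>\<^bsup>q^j\<^esup> = \<lambda> = \<lambda>\<^bsup>q^i\<^esup>\<close>, in which case \<open>\<lambda>\<close> itself is. Since \<open>j-i\<close> is coprime to
  \<open>k\<close>, the fixed elements are exactly those of \<open>K\<close>; the first case contradicts independence.\<close>

text \<open>Multiplication by a nonzero \<open>a\<close> permutes \<open>K - {0}\<close>; comparing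
  the products over this set before and after gives \<open>a ^ card (K - {0}) = 1\<close>.\<close>

lemma subfield_set_power_card:
  fixes K :: "'a :: {field, finite} set"
  assumes K: "subfield_set K" and a: "a \<in> K"
  shows "a ^ card K = a"
proof (cases "a = 0")
  case True
  moreover have "card K > 0" using a by (auto simp: card_gt_0_iff)
  ultimately show ?thesis by (simp add: zero_power)
next
  case False
  let ?U = "K - {0}"
  have mult: "x * y \<in> K" if "x \<in> K" "y \<in> K" for x y
    using K that by (auto simp: subfield_set_def)
  have "(\<lambda>x. a * x) ` ?U = ?U"
  proof (rule card_subset_eq)
    show "(\<lambda>x. a * x) ` ?U \<subseteq> ?U" using False mult a by auto
    show "card ((\<lambda>x. a * x) ` ?U) = card ?U"
      by (rule card_image) (use False in \<open>auto simp: inj_on_def\<close>)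
  qed simp
  moreover have "inj_on (\<lambda>x. a * x) ?U" using False by (auto simp: inj_on_def)
  ultimately have "\<Prod>?U = (\<Prod>x\<in>?U. a * x)"
    using prod.reindex[of "\<lambda>x. a * x" ?U "\<lambda>x. x"] by (simp add: o_def)
  also have "\<dots> = a ^ card ?U * \<Prod>?U" by (simp add: prod.distrib)
  finally have "a ^ card ?U = 1" by simp
  moreover have "card K = Suc (card ?U)"
    using K by (intro card.remove) (simp_all add: subfield_set_def)
  ultimately show ?thesis by simp
qed

text \<open>The elements of \<open>K\<close> are already \<open>card K\<close> roots of
  \<open>X ^ card K - X\<close>, and the degree leaves room for no more.\<close>

lemma subfield_set_eq_power_fixed:
  fixes K :: "'a :: {field, finite} set"
  assumes K: "subfield_set K"
  shows "K = {x. x ^ card K = x}"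
proof (rule card_subset_eq)
  let ?p = "monom 1 (card K) - monom 1 1 :: 'a poly"
  show sub: "K \<subseteq> {x. x ^ card K = x}" using subfield_set_power_card[OF K] by auto
  \<comment> \<open>An exponent above 1 keeps the two monomials of \<open>?p\<close> from
    cancelling.\<close>
  have "card {0, 1 :: 'a} \<le> card K"
    using K by (intro card_mono) (auto simp: subfield_set_def)
  then have 2: "card K > 1" by simp
  then have "coeff ?p (card K) = 1" by simp
  then have nz: "?p \<noteq> 0" by (metis coeff_0 zero_neq_one)
  have "card {x :: 'a. x ^ card K = x} = card {x. poly ?p x = 0}"
    by (simp add: poly_monom)
  also have "\<dots> \<le> degree ?p" by (rule card_poly_roots_bound[OF nz])
  also have "\<dots> \<le> card K"
    using 2 by (intro degree_diff_le) (auto simp: degree_monom_eq)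
  finally show "card K = card {x :: 'a. x ^ card K = x}"
    by (rule le_antisym[OF card_mono[OF finite sub]])
qed simp

lemma iterated_power_fixed:
  fixes x :: "'a :: monoid_mult"
  assumes "x ^ (q ^ n) = x"
  shows "x ^ (q ^ (n * m)) = x"
proof (induction m)
  case (Suc m)
  have "x ^ (q ^ (n * Suc m)) = (x ^ (q ^ n)) ^ (q ^ (n * m))"
    by (simp add: power_add power_mult)
  then show ?case using Suc assms by simp
qed simp

lemma power_fixed_coprime:
  fixes x :: "'a :: monoid_mult"
  assumes "x ^ (q ^ k) = x" "x ^ (q ^ d) = x" "k > 0" "gcd k d = 1"
  shows "x ^ q = x"
proof -
  \<comment> \<open>Bezout over the naturals; \<open>k > 0\<close> allows \<open>k\<close> to stand
    on the larger side.\<close>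
  obtain a b where ab: "k * a = d * b + 1"
    using bezout_nat[of k d] assms by auto
  have "x ^ q = (x ^ (q ^ (d * b))) ^ q"
    using iterated_power_fixed[OF assms(2)] by simp
  also have "\<dots> = x ^ (q ^ (k * a))" unfolding ab by (simp add: mult.commute flip: power_mult)
  also have "\<dots> = x" by (rule iterated_power_fixed[OF assms(1)])
  finally show ?thesis .
qed

text \<open>A further power with exponent \<open>q ^ (k * i - i)\<close> undoes the first one:
  together they form \<open>i\<close> rounds of the identity \<open>z ^ (q ^ k) = z\<close>.\<close>

lemma iterated_power_inject:
  fixes x y :: "'a :: monoid_mult"
  assumes fixed: "x ^ (q ^ k) = x" "y ^ (q ^ k) = y" and "k > 0"
    and eq: "x ^ (q ^ i) = y ^ (q ^ i)"
  shows "x = y"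
proof -
  have *: "(z ^ (q ^ i)) ^ (q ^ (k * i - i)) = z" if "z ^ (q ^ k) = z" for z :: 'a
  proof -
    have "i + (k * i - i) = k * i" using \<open>k > 0\<close> by (cases k) auto
    then show ?thesis
      using iterated_power_fixed[OF that, of i] by (simp flip: power_mult power_add)
  qed
  show ?thesis using *[OF fixed(1)] *[OF fixed(2)] eq by metis
qed

lemma binomial_mem_linearized_polys:
  assumes "i < j"
  shows "monom a (q ^ i) + monom b (q ^ j) \<in> linearized_polys q"
proof -
  let ?c = "\<lambda>n. if n = i then a else if n = j then b else 0"
  have "(\<Sum>n\<le>j. monom (?c n) (q ^ n)) = (\<Sum>n\<in>{i, j}. monom (?c n) (q ^ n))"
    using assms by (intro sum.mono_neutral_right) auto
  also have "\<dots> = monom a (q ^ i) + monom b (q ^ j)" using assms by simp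
  finally have "monom a (q ^ i) + monom b (q ^ j) = (\<Sum>n\<le>j. monom (?c n) (q ^ n))" by (rule sym)
  then show ?thesis
    unfolding linearized_polys_def by - (rule CollectI, rule exI[of _ j], rule exI[of _ ?c])
qed

text \<open>This form separates \<open>l\<close> from \<open>x\<close>: for one \<open>l\<close>,
  the equations of different \<open>x\<close> share their coefficients, which can then be
  eliminated.\<close>

lemma mem_S_set_binomial_iff:
  "l \<in> S_set x (monom 1 m + monom d n) \<longleftrightarrow> (l ^ m - l) * x ^ m = - d * (l ^ n - l) * x ^ n"
proof -
  have "l \<in> S_set x (monom 1 m + monom d n) \<longleftrightarrow>
      l ^ m * x ^ m + d * (l ^ n * x ^ n) = l * (x ^ m + d * x ^ n)"
    by (simp add: S_set_def poly_monom power_mult_distrib)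
  also have "\<dots> \<longleftrightarrow> (l ^ m - l) * x ^ m = - d * (l ^ n - l) * x ^ n"
  proof -
    have "l ^ m * x ^ m + d * (l ^ n * x ^ n) - l * (x ^ m + d * x ^ n)
        = (l ^ m - l) * x ^ m - - d * (l ^ n - l) * x ^ n"
      by (simp add: algebra_simps)
    then show ?thesis by (metis eq_iff_diff_eq_0)
  qed
  finally show ?thesis .
qed

lemma lin_indep_pairD:
  assumes K: "subfield_set K" and "lin_indep_pair K x y"
  shows "x \<noteq> 0" "y \<noteq> 0" "x / y \<notin> K"
proof -
  have K01: "0 \<in> K" "1 \<in> K" using K by (auto simp: subfield_set_def)
  have ind: "a = 0 \<and> b = 0" if "a \<in> K" "b \<in> K" "a * x + b * y = 0" for a b
    using assms(2) that by (auto simp: lin_indep_pair_def)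
  show "x \<noteq> 0" using ind[of 1 0] K01 by auto
  show y: "y \<noteq> 0" using ind[of 0 1] K01 by auto
  show "x / y \<notin> K"
  proof
    assume "x / y \<in> K"
    then have "0 - x / y \<in> K" using K K01 unfolding subfield_set_def by blast
    then show False using ind[of 1 "0 - x / y"] K01 y by simp
  qed
qed

theorem proposition4p8:
  fixes q k i j :: nat
    and K :: "'a :: {field, finite} set"
    and \<delta> :: 'a
  assumes "primepow q" and "k > 0"
    and "card (UNIV :: 'a set) = q ^ k"
    and "subfield_set K" and "card K = q"
    and "i \<ge> 1" and "j > i" and "gcd k (j - i) = 1"
    and "\<delta> \<noteq> 0"
  shows "Sidon_space_poly K (monom 1 (q ^ i) + monom \<delta> (q ^ j))"
proof -
  let ?f = "monom 1 (q ^ i) + monom \<delta> (q ^ j)"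
  \<comment> \<open>The whole field is a subfield of itself, of cardinality
    \<open>q ^ k\<close>.\<close>
  have UNIV_fixed: "x ^ (q ^ k) = x" for x :: 'a
    using subfield_set_power_card[of UNIV x] assms(3) by (simp add: subfield_set_def)
  have K_iff: "x \<in> K \<longleftrightarrow> x ^ q = x" for x
    using subfield_set_eq_power_fixed[OF assms(4)] assms(5) by blast
  \<comment> \<open>Serves both cases below: applied to \<open>l\<close> in the first, to
    \<open>x / y\<close> in the second.\<close>
  have fixed_in_K: "x \<in> K" if "x ^ (q ^ i) = x ^ (q ^ j)" for x
  proof -
    have "(x ^ (q ^ (j - i))) ^ (q ^ i) = x ^ (q ^ i)"
      using that assms(7) by (simp flip: power_mult power_add)
    then have "x ^ (q ^ (j - i)) = x"
      by (rule iterated_power_inject[OF UNIV_fixed UNIV_fixed assms(2)])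
    then show ?thesis
      using power_fixed_coprime[OF UNIV_fixed _ assms(2,8)] K_iff by blast
  qed
  have "S_set x ?f \<inter> S_set y ?f = K" if "lin_indep_pair K x y" for x y
  proof
    note nz = lin_indep_pairD[OF assms(4) that]
    show "K \<subseteq> S_set x ?f \<inter> S_set y ?f"
    proof
      fix l assume "l \<in> K"
      then have "l ^ (q ^ n) = l" for n
        using iterated_power_fixed[of l q 1 n] K_iff by simp
      then show "l \<in> S_set x ?f \<inter> S_set y ?f" by (simp add: mem_S_set_binomial_iff)
    qed
    show "S_set x ?f \<inter> S_set y ?f \<subseteq> K"
    proof
      fix l assume "l \<in> S_set x ?f \<inter> S_set y ?f"
      then have ex: "(l ^ q ^ i - l) * x ^ q ^ i = - \<delta> * (l ^ q ^ j - l) * x ^ q ^ j"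
        and ey: "(l ^ q ^ i - l) * y ^ q ^ i = - \<delta> * (l ^ q ^ j - l) * y ^ q ^ j"
        by (simp_all only: mem_S_set_binomial_iff Int_iff)
      show "l \<in> K"
      proof (cases "l ^ q ^ j = l")
        case True
        then have "l ^ q ^ i = l" using ex nz(1) by simp
        then show ?thesis using True fixed_in_K by simp
      next
        case False
        define A B where "A = l ^ q ^ i - l" and "B = - \<delta> * (l ^ q ^ j - l)"
        have "B \<noteq> 0" using False assms(9) by (simp add: B_def)
        have AB: "A * x ^ q ^ i = B * x ^ q ^ j" "A * y ^ q ^ i = B * y ^ q ^ j"
          using ex ey by (simp_all only: A_def B_def)
        have "A \<noteq> 0" using AB(1) \<open>B \<noteq> 0\<close> nz(1) by auto
        \<comment> \<open>The equation for \<open>x\<close> times the reversed equation for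
          \<open>y\<close>, so that \<open>A * B\<close> stands on both sides and cancels.\<close>
        have "A * B * (x ^ q ^ i * y ^ q ^ j) = A * B * (x ^ q ^ j * y ^ q ^ i)"
          using arg_cong2[of _ _ _ _ "(*)", OF AB(1) AB(2)[symmetric]] by (simp only: ac_simps)
        then have "x ^ q ^ i * y ^ q ^ j = x ^ q ^ j * y ^ q ^ i"
          using \<open>A \<noteq> 0\<close> \<open>B \<noteq> 0\<close> by simp
        then have "(x / y) ^ q ^ i = (x / y) ^ q ^ j"
          using nz(2) by (simp add: power_divide field_simps)
        then show ?thesis using fixed_in_K nz(3) by blast
      qed
    qed
  qed
  then show ?thesis
    using binomial_mem_linearized_polys[OF assms(7)] assms(5)
    by (auto simp: Sidon_space_poly_def)
qed

end
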